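(* Let $n\ge5$. Suppose there is a generalized substitution which, applied to threshold words from $\mathbf T_n$, generates a set of threshold words from $\mathbf T_n$ with strict exponential growth, and such that images of different letters are always different. Then $$\forall\varepsilon>0\ \ \exists w\in\mathbf T_n\cap A_n^{\omega}\ \ \exists N\in\mathbb N:\quad \text{every factor } xyx \text{ of } w \text{ with } |x|\ge N \text{ satisfies } \exp(xyx)\le1+\varepsilon .$$
   Context: $A_n$ is an alphabet of $n$ letters, $A_n^\omega$ is the set of right-infinite words over $A_n$. The period $\mathrm{per}(v)$ of a finite nonempty word is the least $p\ge1$ with $v[i]=v[i+p]$ for $1\le i\le|v|-p$; $\exp(v)=|v|/\mathrm{per}(v)$. $\mathbf T_n$ is the set of (finite or infinite) words over $A_n$ all of whose nonempty finite factors $v$ satisfy $\exp(v)\le\frac n{n-1}$ (threshold words). Generalized substitution: for some fixed $L$, each letter $a\in A_n$ has a set $\mathbf V_a\subset A_n^L$ of possible images, and the sets $\mathbf V_a$ are pairwise disjoint (images of different letters are always different). Letters of a word $w$ are replaced one by one from left to right, $w[j]$ by some $\phi_j\in\mathbf V_{w[j]}$; the choices allowed at each step may depend on $w$ and on the previously chosen images. An image of $w$ is a word $\phi_1\cdots\phi_{|w|}$ obtained by allowed choices; restricting an image of $w$ to a prefix of $w$ gives an image of that prefix. The hypothesis is that every word $w\in\mathbf T_n$ has at least one image and all its images belong to $\mathbf T_n$. Strict exponential growth: the generated images form a tree (under extension of prefixes) in which the number of branches at least doubles after at most a constant number of further letters, i.e. there is a constant $p$ such that for every $w\in\mathbf T_n$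 and every $m$ with $m+p\le|w|$, every image of the prefix of $w$ of length $m$ obtained in the course of the procedure has at least two different extensions, obtained by allowed choices, to images of the prefix of $w$ of length $m+p$. *)

theory Defs
  imports Complex_Main "HOL-Library.Extended_Nat" "HOL-Library.Sublist"
    "HOL-Library.Omega_Words_Fun"
begin

text \<open>The alphabet with \<open>n\<close> letters is \<open>{..<n} :: nat set\<close>; positions are counted from \<open>0\<close>.\<close>

datatype 'a fiword = Finite "'a list" | Infinite "'a word"

fun wlen :: "'a fiword \<Rightarrow> enat" where
  "wlen (Finite xs) = enat (length xs)"
| "wlen (Infinite f) = \<infinity>"

fun wnth :: "'a fiword \<Rightarrow> nat \<Rightarrow> 'a" where
  "wnth (Finite xs) i = xs ! i"
| "wnth (Infinite f) i = f i"

fun wtake :: "nat \<Rightarrow> 'a fiword \<Rightarrow> 'a list" where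
  "wtake m (Finite xs) = take m xs"
| "wtake m (Infinite f) = subsequence f 0 m"

fun letters :: "'a fiword \<Rightarrow> 'a set" where
  "letters (Finite xs) = set xs"
| "letters (Infinite f) = range f"

fun factors :: "'a fiword \<Rightarrow> 'a list set" where
  "factors (Finite xs) = {v. sublist v xs}"
| "factors (Infinite f) = {subsequence f i j | i j. i \<le> j}"

definition per :: "'a list \<Rightarrow> nat" where
  "per v = (LEAST p. p \<ge> 1 \<and> (\<forall>i. i + p < length v \<longrightarrow> v ! i = v ! (i + p)))"

definition expo :: "'a list \<Rightarrow> real" where
  "expo v = real (length v) / real (per v)"

definition threshold_words :: "nat \<Rightarrow> nat fiword set" where
  "threshold_words n =
     {w. letters w \<subseteq> {..<n} \<and>
         (\<forall>v \<in> factors w. v \<noteq> [] \<longrightarrow> expo v \<le> real n / (real n - 1))}"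

text \<open>
  The choices of a generalized substitution are given by a function \<open>C\<close>: if the letters of \<open>w\<close>
  at the positions below \<open>j\<close> have been replaced by the blocks listed in \<open>us\<close> (so \<open>length us = j\<close>),
  then \<open>C w us\<close> is the set of blocks that may replace the letter at position \<open>j\<close>. It may depend
  on all of \<open>w\<close>, including the letters not yet read.

  \<open>allowed_choices C w \<Phi>\<close> says that the word of blocks \<open>\<Phi>\<close>, which may be shorter than \<open>w\<close>,
  arises when \<open>w\<close> is processed from left to right.
\<close>

definition allowed_choices ::
    "('a fiword \<Rightarrow> 'a list list \<Rightarrow> 'a list set) \<Rightarrow> 'a fiword \<Rightarrow> 'a list fiword \<Rightarrow> bool" where
  "allowed_choices C w \<Phi> \<longleftrightarrow>
     wlen \<Phi> \<le> wlen w \<and> (\<forall>j. enat j < wlen \<Phi> \<longrightarrow> wnth \<Phi> j \<in> C w (wtake j \<Phi>))"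

definition complete_choices ::
    "('a fiword \<Rightarrow> 'a list list \<Rightarrow> 'a list set) \<Rightarrow> 'a fiword \<Rightarrow> 'a list fiword set" where
  "complete_choices C w = {\<Phi>. allowed_choices C w \<Phi> \<and> wlen \<Phi> = wlen w}"

text \<open>Concatenation of a finite or infinite sequence of blocks, all of length \<open>L > 0\<close>.\<close>

fun flatten :: "nat \<Rightarrow> 'a list fiword \<Rightarrow> 'a fiword" where
  "flatten L (Finite us) = Finite (concat us)"
| "flatten L (Infinite \<phi>) = Infinite (\<lambda>k. \<phi> (k div L) ! (k mod L))"

definition images ::
    "nat \<Rightarrow> ('a fiword \<Rightarrow> 'a list list \<Rightarrow> 'a list set) \<Rightarrow> 'a fiword \<Rightarrow> 'a fiword set" where
  "images L C w = flatten L ` complete_choices C w"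

text \<open>
  The last clause is the compatibility with prefixes. It is stated for sequences of blocks; as all
  blocks have the same length, such a sequence and its concatenation determine each other.
\<close>

definition generalized_substitution ::
    "nat \<Rightarrow> nat \<Rightarrow> (nat \<Rightarrow> nat list set) \<Rightarrow> (nat fiword \<Rightarrow> nat list list \<Rightarrow> nat list set) \<Rightarrow> bool"
  where
  "generalized_substitution n L V C \<longleftrightarrow>
     (\<forall>a<n. V a \<subseteq> {u. length u = L \<and> set u \<subseteq> {..<n}}) \<and>
     (\<forall>w \<in> threshold_words n. \<forall>us. enat (length us) < wlen w \<longrightarrow>
        C w us \<subseteq> V (wnth w (length us))) \<and>
     (\<forall>w \<in> threshold_words n. \<forall>\<Phi> \<in> complete_choices C w. \<forall>m. enat m \<le> wlen w \<longrightarrow>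
        Finite (wtake m \<Phi>) \<in> complete_choices C (Finite (wtake m w)))"

definition distinct_images :: "nat \<Rightarrow> (nat \<Rightarrow> nat list set) \<Rightarrow> bool" where
  "distinct_images n V \<longleftrightarrow> (\<forall>a<n. \<forall>b<n. a \<noteq> b \<longrightarrow> V a \<inter> V b = {})"

definition generates_threshold_words ::
    "nat \<Rightarrow> nat \<Rightarrow> (nat fiword \<Rightarrow> nat list list \<Rightarrow> nat list set) \<Rightarrow> bool" where
  "generates_threshold_words n L C \<longleftrightarrow>
     (\<forall>w \<in> threshold_words n. images L C w \<noteq> {} \<and> images L C w \<subseteq> threshold_words n)"

text \<open>
  The first conjunct only says that the doubling takes place at least once: it excludes a \<open>p\<close>
  exceeding the lengths of all threshold words, for which the second conjunct would be vacuous and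
  the identity substitution (\<open>L = 1\<close>) would count as growing. It holds for every \<open>p\<close> by Dejean's
  theorem (threshold words of every length exist over every alphabet with at least two letters).
\<close>

definition strict_exponential_growth ::
    "nat \<Rightarrow> (nat fiword \<Rightarrow> nat list list \<Rightarrow> nat list set) \<Rightarrow> bool" where
  "strict_exponential_growth n C \<longleftrightarrow>
     (\<exists>p. (\<exists>w \<in> threshold_words n. enat p \<le> wlen w) \<and>
        (\<forall>w \<in> threshold_words n. \<forall>m. enat (m + p) \<le> wlen w \<longrightarrow>
           (\<forall>us. length us = m \<and> allowed_choices C w (Finite us) \<longrightarrow>
              (\<exists>vs vs'. length vs = p \<and> length vs' = p \<and>
                 allowed_choices C w (Finite (us @ vs)) \<and>
                 allowed_choices C w (Finite (us @ vs')) \<and>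
                 concat (us @ vs) \<noteq> concat (us @ vs')))))"

end

theory Submission
  imports Defs
begin

text \<open>
  A single application of the generalized substitution, to one infinite threshold word \<open>w\<close>,
  already yields the required word: every sequence of allowed choices gives a threshold word, so
  only the long repetitions have to be avoided, and the growth leaves enough freedom for that.

  An infinite threshold word exists because the blocks have length \<open>L \<ge> 2\<close>
  (\<open>block_length_ge_2\<close>): iterated images of a letter are threshold words of unbounded length, and
  compactness does the rest (\<open>infinite_threshold_word\<close>). The bound on \<open>L\<close> comes from the
  disjointness of the sets of images: if \<open>L = 1\<close>, these \<open>n\<close> nonempty disjoint sets consist of
  words of one letter over \<open>n\<close> letters and are therefore singletons, which leaves no choice.

  Let \<open>p\<close> be the constant of the growth. The images of \<open>w\<close> contain a complete binary tree: a finite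
  bit sequence \<open>b\<close> selects a word \<open>G b\<close> of length \<open>M * length b\<close> with \<open>M = L * p\<close>
  (\<open>binary_tree_of_choices\<close>). In a factor with period \<open>q\<close> whose length is \<open>q + e\<close>, the
  last \<open>e\<close> letters are determined by \<open>q\<close> and by what precedes them. If the exponent exceeds
  \<open>1 + \<epsilon>\<close>, then \<open>q < e / \<epsilon>\<close>. The last \<open>e\<close> letters cover \<open>t \<approx> e / M\<close> complete
  steps of the tree, so after each bit sequence only a number linear in \<open>t\<close> of the \<open>2 ^ t\<close>
  continuations by \<open>t\<close> bits produce such a repetition (\<open>avoid_long_repetitions\<close>). A counting
  argument gives an infinite bit sequence that avoids all these continuations for all large \<open>t\<close>
  (\<open>avoid_few_continuations\<close>).
\<close>

section \<open>Infinite words from finite ones\<close>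

text \<open>
  Koenig's lemma for the tree \<open>S\<close> of words over a finite alphabet. The invariant along the branch
  is that the word built so far has extensions in \<open>S\<close> of every length.
\<close>

lemma koenig_lists:
  fixes S :: "'a list set"
  assumes A: "finite A" "\<And>u. u \<in> S \<Longrightarrow> set u \<subseteq> A"
    and closed: "\<And>u v. u @ v \<in> S \<Longrightarrow> u \<in> S"
    and long: "\<And>k. \<exists>u\<in>S. length u = k"
  shows "\<exists>f. \<forall>k. subsequence f 0 k \<in> S"
proof -
  define E where "E u \<longleftrightarrow> (\<forall>k. \<exists>v. length v = k \<and> u @ v \<in> S)" for u
  have E0: "E []" using long unfolding E_def by (metis append_Nil)
  \<comment> \<open>If no letter preserved the invariant, an extension longer than all the bounds for the
    finitely many letters could not exist.\<close>
  have E1: "\<exists>a. E (u @ [a])" if u: "E u" for u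
  proof (rule ccontr)
    assume "\<not> ?thesis"
    then have "\<forall>a. \<exists>k. \<forall>v. length v = k \<longrightarrow> u @ [a] @ v \<notin> S" unfolding E_def by auto
    then obtain h where h: "\<And>a v. length v = h a \<Longrightarrow> u @ [a] @ v \<notin> S" by metis
    obtain v where v: "length v = Suc (Max (h ` A))" "u @ v \<in> S"
      using u unfolding E_def by blast
    then obtain a v' where av: "v = a # v'" by (cases v) auto
    have "a \<in> A" using A(2)[OF v(2)] av by auto
    then have "h a \<le> length v'" using v(1) av A(1) by simp
    then have "length (take (h a) v') = h a" by simp
    moreover have "(u @ [a] @ take (h a) v') @ drop (h a) v' \<in> S"
      using v(2) av by simp
    ultimately show False using h closed by blast
  qed
  obtain c where c: "\<And>u. E u \<Longrightarrow> E (u @ [c u])" using E1 by metis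
  define g where "g = rec_nat [] (\<lambda>_ u. u @ [c u])"
  have g: "g 0 = []" "g (Suc k) = g k @ [c (g k)]" for k by (simp_all add: g_def)
  have "E (g k)" for k by (induction k) (use E0 c g in auto)
  then have "g k \<in> S" for k unfolding E_def by (metis append.right_neutral length_0_conv)
  moreover have "map (\<lambda>k. c (g k)) [0..<k] = g k" for k by (induction k) (use g in auto)
  ultimately show ?thesis unfolding subsequence_def by metis
qed

section \<open>Periods and threshold words\<close>

lemma per_pos: "per v \<ge> 1"
  and per_nth: "i + per v < length v \<Longrightarrow> v ! i = v ! (i + per v)"
proof -
  have "\<exists>p. p \<ge> 1 \<and> (\<forall>i. i + p < length v \<longrightarrow> v ! i = v ! (i + p))"
    by (rule exI[of _ "Suc (length v)"]) auto
  from LeastI_ex[OF this] show "per v \<ge> 1" "i + per v < length v \<Longrightarrow> v ! i = v ! (i + per v)"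
    unfolding per_def by blast+
qed

lemma per_le_border:
  assumes "x @ y \<noteq> []"
  shows "per (x @ y @ x) \<le> length (x @ y)"
  unfolding per_def
proof (rule Least_le, intro conjI allI impI)
  show "1 \<le> length (x @ y)" using assms by (cases "x @ y") auto
  fix i assume i: "i + length (x @ y) < length (x @ y @ x)"
  then have "(x @ y @ x) ! i = x ! i" by (simp add: nth_append)
  moreover have "((x @ y) @ x) ! (i + length (x @ y)) = x ! i"
    by (metis add.commute nth_append_length_plus)
  ultimately show "(x @ y @ x) ! i = (x @ y @ x) ! (i + length (x @ y))" by simp
qed

lemma threshold_words_prefix:
  assumes "Finite (u @ v) \<in> threshold_words n"
  shows "Finite u \<in> threshold_words n"
proof -
  have "factors (Finite u) \<subseteq> factors (Finite (u @ v))"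
    by (auto intro: sublist_order.order.trans sublist_append_rightI)
  with assms show ?thesis unfolding threshold_words_def by auto
qed

lemma threshold_words_Infinite:
  assumes "\<And>k. Finite (subsequence f 0 k) \<in> threshold_words n"
  shows "Infinite f \<in> threshold_words n"
proof -
  have "f i < n" for i
    using assms[of "Suc i"] unfolding threshold_words_def by (auto simp: subsequence_def)
  moreover have "expo v \<le> real n / (real n - 1)"
    if v: "v \<in> factors (Infinite f)" "v \<noteq> []" for v
  proof -
    obtain i j where ij: "v = subsequence f i j" "i \<le> j" using v(1) by auto
    have "subsequence f 0 j = subsequence f 0 i @ v @ []"
      using ij upt_add_eq_append[of 0 i "j - i"] by (simp add: subsequence_def flip: map_append)
    then have "sublist v (subsequence f 0 j)" unfolding sublist_def by blast
    then show ?thesis using assms[of j] v(2) unfolding threshold_words_def by auto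
  qed
  ultimately show ?thesis unfolding threshold_words_def by auto
qed

lemma threshold_words_letter:
  assumes "n \<ge> 2" "a < n"
  shows "Finite [a] \<in> threshold_words n"
proof -
  have "expo v \<le> real n / (real n - 1)" if "sublist v [a]" for v
  proof -
    have "length v \<le> 1" using sublist_length_le[OF that] by simp
    then have "length v \<le> per v" using per_pos[of v] by linarith
    then have "expo v \<le> 1" unfolding expo_def using per_pos[of v] by (simp add: divide_le_eq)
    also have "1 \<le> real n / (real n - 1)" using assms by (simp add: le_divide_eq)
    finally show ?thesis .
  qed
  then show ?thesis using assms unfolding threshold_words_def by auto
qed

section \<open>Avoiding few continuations of each length\<close>

text \<open>
  With \<open>a k\<close> the number of good words of length \<open>k\<close>, an extension of a good word by one bit that is
  not good ends in a forbidden continuation of length \<open>t\<close> after a good word of length \<open>k + 1 - t\<close>.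
  Hence \<open>a (k + 1) \<ge> 2 * a k - (\<Sum>t. K * t * a (k + 1 - t))\<close>, summed over the lengths \<open>t\<close> that
  are taken into account. If \<open>a\<close> has grown by the factor \<open>3/2\<close> up to \<open>k\<close>, the sum is at most
  \<open>a k * (\<Sum>t. K * t * (2/3) ^ (t - 1))\<close>. This is a tail of a convergent series, so it is at most
  \<open>a k / 2\<close> when short continuations are ignored, and the growth by \<open>3/2\<close> persists. Any factor
  strictly between \<open>1\<close> and \<open>2\<close> would serve.
\<close>

lemma avoid_few_continuations:
  fixes F :: "bool list \<Rightarrow> nat \<Rightarrow> bool list set" and K :: nat
  assumes F: "\<And>u t. finite (F u t)" "\<And>u t. card (F u t) \<le> K * t"
  shows "\<exists>t0 f. \<forall>s t. t \<ge> t0 \<longrightarrow> subsequence f s (s + t) \<notin> F (subsequence f 0 s) t"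
proof -
  \<comment> \<open>Here and below a forbidden continuation has length \<open>Suc r\<close>.\<close>
  have "summable (\<lambda>r. real K * (real (Suc r) * (2/3) ^ r))"
    by (rule summable_mult, rule sums_summable, rule geometric_deriv_sums) simp
  then obtain r0 where r0:
    "\<And>m k. m \<ge> r0 \<Longrightarrow> norm (\<Sum>r=m..<k. real K * (real (Suc r) * (2/3) ^ r)) < 1/2"
    unfolding summable_Cauchy by (meson half_gt_zero zero_less_one)
  define good where
    "good c \<longleftrightarrow> (\<forall>u d e. c = u @ d @ e \<and> length d \<ge> Suc r0 \<longrightarrow> d \<notin> F u (length d))" for c
  define W where "W k = {c. good c \<and> length c = k}" for k
  have good_prefix: "good u" if "good (u @ v)" for u v
    using that unfolding good_def by (metis append.assoc)
  have finW: "finite (W k)" for k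
    by (rule finite_subset[of _ "{c. set c \<subseteq> UNIV \<and> length c = k}"])
       (auto simp: W_def intro: finite_lists_length_eq[of "UNIV :: bool set", simplified])
  have step: "2 * card (W k) \<le> card (W (Suc k)) + (\<Sum>r=r0..<Suc k. card (W (k - r)) * (K * Suc r))"
    for k
  proof -
    define X where "X = (\<lambda>(c, x). c @ [x]) ` (W k \<times> (UNIV :: bool set))"
    define Y where "Y = (\<Union>r\<in>{r0..<Suc k}. \<Union>u\<in>W (k - r). (\<lambda>d. u @ d) ` F u (Suc r))"
    have "X \<subseteq> W (Suc k) \<union> Y"
    proof
      fix b assume "b \<in> X"
      then obtain c x where b: "b = c @ [x]" "good c" "length c = k" unfolding X_def W_def by auto
      show "b \<in> W (Suc k) \<union> Y"
      proof (cases "good b")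
        case True then show ?thesis using b unfolding W_def by simp
      next
        case False
        then obtain u d e where ude: "b = u @ d @ e" "length d \<ge> Suc r0" "d \<in> F u (length d)"
          unfolding good_def by blast
        \<comment> \<open>The word \<open>c\<close> is good, so the forbidden continuation must use the new bit.\<close>
        have e: "e = []"
        proof (rule ccontr)
          assume "e \<noteq> []"
          then have "c = u @ d @ butlast e" using ude(1) b(1)
            by (metis append_is_Nil_conv butlast_append butlast_snoc)
          then show False using b(2) ude(2,3) unfolding good_def by blast
        qed
        have ne: "d \<noteq> []" using ude(2) by auto
        have c: "c = u @ butlast d" using ude(1) b(1) e ne
          by (metis append.right_neutral butlast_append butlast_snoc)
        define r where "r = length d - 1"
        have r: "length d = Suc r" using ude(2) by (simp add: r_def)
        have "k = length u + r" using b(3) c r by simp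
        then have "u \<in> W (k - r)" "r \<in> {r0..<Suc k}"
          using good_prefix b(2) c ude(2) r unfolding W_def by auto
        moreover have "b = u @ d" using ude(1) e by simp
        ultimately have "b \<in> Y" unfolding Y_def using ude(3) r
          by (intro UN_I[of r] UN_I[of u]) auto
        then show ?thesis ..
      qed
    qed
    moreover have finY: "finite Y" unfolding Y_def using finW F(1) by auto
    ultimately have "card X \<le> card (W (Suc k)) + card Y"
      by (meson card_Un_le card_mono finW finite_UnI le_trans)
    moreover have "card X = 2 * card (W k)"
      unfolding X_def by (subst card_image) (auto simp: inj_on_def card_cartesian_product)
    moreover have "card Y \<le> (\<Sum>r=r0..<Suc k. card (W (k - r)) * (K * Suc r))"
    proof -
      have "card (\<Union>u\<in>W (k - r). (\<lambda>d. u @ d) ` F u (Suc r)) \<le> card (W (k - r)) * (K * Suc r)" for r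
      proof -
        have "card (\<Union>u\<in>W (k - r). (\<lambda>d. u @ d) ` F u (Suc r))
            \<le> (\<Sum>u\<in>W (k - r). card ((\<lambda>d. u @ d) ` F u (Suc r)))"
          by (rule card_UN_le[OF finW])
        also have "\<dots> \<le> (\<Sum>u\<in>W (k - r). K * Suc r)"
          by (rule sum_mono) (rule le_trans[OF card_image_le[OF F(1)] F(2)])
        finally show ?thesis by simp
      qed
      then show ?thesis unfolding Y_def
        by (rule le_trans[OF card_UN_le[OF finite_atLeastLessThan] sum_mono])
    qed
    ultimately show ?thesis by linarith
  qed
  have growth: "3/2 * real (card (W k)) \<le> real (card (W (Suc k)))" for k
  proof (induction k rule: less_induct)
    case (less k)
    have earlier: "r \<le> k \<Longrightarrow> real (card (W (k - r))) \<le> (2/3) ^ r * real (card (W k))" for r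
    proof (induction r)
      case (Suc r)
      have "3/2 * real (card (W (k - Suc r))) \<le> real (card (W (k - r)))"
        using less.IH[of "k - Suc r"] Suc.prems by (simp add: Suc_diff_Suc)
      with Suc show ?case by simp
    qed simp
    have "(\<Sum>r=r0..<Suc k. real (card (W (k - r))) * (real K * real (Suc r)))
        \<le> (\<Sum>r=r0..<Suc k. (2/3) ^ r * real (card (W k)) * (real K * real (Suc r)))"
      by (intro sum_mono mult_right_mono earlier) auto
    also have "\<dots> = real (card (W k)) * (\<Sum>r=r0..<Suc k. real K * (real (Suc r) * (2/3) ^ r))"
      unfolding sum_distrib_left by (intro sum.cong) (simp_all only: mult_ac)
    also have "\<dots> \<le> real (card (W k)) * (1/2)"
      using r0[of r0 "Suc k"] by (intro mult_left_mono) auto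
    finally have "(\<Sum>r=r0..<Suc k. real (card (W (k - r))) * (real K * real (Suc r)))
        \<le> real (card (W k)) / 2" by simp
    moreover have "real (2 * card (W k)) \<le> real (card (W (Suc k)) +
        (\<Sum>r=r0..<Suc k. card (W (k - r)) * (K * Suc r)))"
      using step[of k] of_nat_le_iff by blast
    then have "2 * real (card (W k)) \<le> real (card (W (Suc k))) +
        (\<Sum>r=r0..<Suc k. real (card (W (k - r))) * (real K * real (Suc r)))"
      by (simp only: of_nat_add of_nat_sum of_nat_mult of_nat_numeral)
    ultimately show ?case by linarith
  qed
  have pos: "card (W k) > 0" for k
  proof (induction k)
    case 0
    have "W 0 = {[]}" unfolding W_def good_def by auto
    then show ?case by simp
  next
    case (Suc k) then show ?case using growth[of k] by linarith
  qed
  have "\<exists>f. \<forall>k. subsequence f 0 k \<in> {c. good c}"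
  proof (rule koenig_lists[of "UNIV :: bool set"])
    show "\<exists>u\<in>{c. good c}. length u = k" for k
      using pos[of k] unfolding W_def by (auto simp: card_gt_0_iff)
  qed (use good_prefix in auto)
  then obtain f where f: "\<And>k. good (subsequence f 0 k)" by auto
  have "subsequence f s (s + t) \<notin> F (subsequence f 0 s) t" if "t \<ge> Suc r0" for s t
  proof -
    have "subsequence f 0 (s + t) = subsequence f 0 s @ subsequence f s (s + t) @ []"
      by (simp add: subsequence_def flip: map_append upt_add_eq_append)
    moreover have "length (subsequence f s (s + t)) = t" by (simp add: subsequence_def)
    ultimately show ?thesis using f[of "s + t"] that unfolding good_def by metis
  qed
  then show ?thesis by blast
qed

section \<open>Avoiding long repetitions in a binary tree of words\<close>

text \<open>
  The word \<open>G b\<close> is the one selected by the bits \<open>b\<close>, with \<open>M\<close> letters for each bit. A repetition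
  is given by its start \<open>i\<close>, its period \<open>q\<close> and its excess \<open>e\<close>, the length minus the period. A bound
  on \<open>e / q\<close> is a bound on the exponent minus \<open>1\<close>. The bits \<open>f\<close> have to be found before
  the word \<open>z\<close>, which the tree determines along the branch \<open>f\<close>.
\<close>

lemma avoid_long_repetitions:
  fixes G :: "bool list \<Rightarrow> 'a list" and M :: nat and \<epsilon> :: real
  assumes len: "\<And>b. length (G b) = M * length b"
    and ext: "\<And>b x. \<exists>h. G (b @ [x]) = G b @ h"
    and branch: "\<And>b. G (b @ [True]) \<noteq> G (b @ [False])"
    and \<epsilon>: "\<epsilon> > 0"
  shows "\<exists>N f. \<forall>z. (\<forall>k. subsequence z 0 (M * k) = G (subsequence f 0 k)) \<longrightarrow>
           (\<forall>i q e. e \<ge> N \<and> q \<ge> 1 \<and> (\<forall>j<e. z (i + j) = z (i + j + q)) \<longrightarrow>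
              real e \<le> \<epsilon> * real q)"
proof -
  have M: "M > 0" using branch[of "[]"] len[of "[True]"] len[of "[False]"] by (cases M) auto
  have ext': "take (M * length b) (G (b @ c)) = G b" for b c
  proof (induction c rule: rev_induct)
    case Nil then show ?case by (simp add: len)
  next
    case (snoc x c)
    obtain h where h: "G ((b @ c) @ [x]) = G (b @ c) @ h" using ext by blast
    show ?case using snoc by (simp add: h[simplified] len)
  qed
  have inj: "G b = G c \<Longrightarrow> length b = length c \<Longrightarrow> b = c" for b c
  proof (induction b arbitrary: c rule: rev_induct)
    case (snoc x b)
    obtain y c' where c: "c = c' @ [y]" using snoc.prems(2) by (cases c rule: rev_cases) auto
    have "G b = G c'"
      using ext'[of b "[x]"] ext'[of c' "[y]"] snoc.prems c by auto
    then have "b = c'" using snoc c by auto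
    then show ?case using branch[of b] snoc.prems(1) c by (cases x; cases y) auto
  qed simp
  define K where "K = nat \<lceil>3 * real M / \<epsilon>\<rceil>"
  \<comment> \<open>\<open>Q u d q\<close>: the part of the word that belongs to the bits \<open>d\<close> after \<open>u\<close> continues with period
    \<open>q\<close>. Such a part is covered by a repetition whose second occurrence of the border contains it;
    the bound on \<open>q\<close> keeps the positions \<open>j - q\<close> from being truncated.\<close>
  define Q where "Q u d q \<longleftrightarrow> q \<ge> 1 \<and> q \<le> M * length u \<and>
     (\<forall>j. M * length u \<le> j \<and> j < M * length (u @ d) \<longrightarrow> G (u @ d) ! j = G (u @ d) ! (j - q))"
    for u d q
  define F where "F u t = {d. length d = t \<and> (\<exists>q. q \<in> {1..K * t} \<and> Q u d q)}" for u t
  have uniq: "d = d'" if d: "length d = length d'" "Q u d q" "Q u d' q" for u d d' q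
  proof -
    have "j < M * length (u @ d) \<longrightarrow> G (u @ d) ! j = G (u @ d') ! j" for j
    proof (induction j rule: less_induct)
      case (less j)
      show ?case
      proof (cases "j < M * length u")
        case True
        then show ?thesis using ext'[of u d] ext'[of u d'] by (metis nth_take)
      next
        case False
        have "j - q < j" using d(2) False unfolding Q_def by auto
        with less[of "j - q"] show ?thesis using d False unfolding Q_def by auto
      qed
    qed
    then have "G (u @ d) = G (u @ d')" using d(1) by (intro nth_equalityI) (auto simp: len)
    then show ?thesis using inj d(1) by fastforce
  qed
  have F: "finite (F u t)" "card (F u t) \<le> K * t" for u t
  proof -
    \<comment> \<open>By \<open>uniq\<close>, the possible periods enumerate the forbidden continuations.\<close>
    define T where "T = (\<lambda>q. THE d. length d = t \<and> Q u d q) ` {1..K * t}"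
    have "F u t \<subseteq> T"
    proof
      fix d assume "d \<in> F u t"
      then obtain q where q: "length d = t" "q \<in> {1..K * t}" "Q u d q" unfolding F_def by auto
      have "(THE d. length d = t \<and> Q u d q) = d"
      proof (rule the_equality)
        show "length d = t \<and> Q u d q" using q by blast
        show "d' = d" if "length d' = t \<and> Q u d' q" for d'
          by (rule uniq[of _ _ u q]) (simp_all only: that q)
      qed
      then show "d \<in> T" unfolding T_def by (intro image_eqI[OF _ q(2)]) (rule sym)
    qed
    moreover have "finite T" "card T \<le> K * t"
      unfolding T_def using card_image_le[of "{1..K * t}"] by auto
    ultimately show "finite (F u t)" "card (F u t) \<le> K * t"
      by (meson finite_subset, meson card_mono le_trans)
  qed
  obtain t0 f where f: "\<And>s t. t \<ge> t0 \<Longrightarrow> subsequence f s (s + t) \<notin> F (subsequence f 0 s) t"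
    using avoid_few_continuations[of F K] F by blast
  have "real e \<le> \<epsilon> * real q"
    if z: "\<And>k. subsequence z 0 (M * k) = G (subsequence f 0 k)"
      and e: "e \<ge> (t0 + 3) * M" and q: "q \<ge> 1" and rep: "\<And>j. j < e \<Longrightarrow> z (i + j) = z (i + j + q)"
    for z i q e
  proof (rule ccontr)
    assume "\<not> ?thesis"
    then have lt: "real q < real e / \<epsilon>" using \<epsilon> by (simp add: pos_less_divide_eq mult.commute)
    \<comment> \<open>The steps \<open>s\<close> to \<open>s + t - 1\<close> of the tree lie inside the last \<open>e\<close> letters; the incomplete
      steps at both ends cost fewer than \<open>2 * M\<close> letters.\<close>
    define s where "s = Suc ((i + q) div M)"
    define t where "t = (i + q + e) div M - s"
    have s: "i + q \<le> s * M" "s * M \<le> i + q + M"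
    proof -
      have "(i + q) div M * M + (i + q) mod M = i + q" by simp
      moreover have "(i + q) mod M < M" using M by simp
      moreover have "s * M = M + (i + q) div M * M" by (simp add: s_def)
      ultimately show "i + q \<le> s * M" "s * M \<le> i + q + M" by linarith+
    qed
    have e3: "e \<ge> t0 * M + 3 * M" using e by (simp add: algebra_simps)
    have "i + q + M \<le> i + q + e" using e3 by linarith
    then have "Suc ((i + q) div M) \<le> (i + q + e) div M"
      using div_le_mono[of "i + q + M" "i + q + e" M] M by simp
    then have st: "s + t = (i + q + e) div M" unfolding s_def t_def by simp
    have st': "(s + t) * M \<le> i + q + e" "i + q + e < (s + t) * M + M"
    proof -
      have "(s + t) * M + (i + q + e) mod M = i + q + e" unfolding st by simp
      moreover have "(i + q + e) mod M < M" using M by simp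
      ultimately show "(s + t) * M \<le> i + q + e" "i + q + e < (s + t) * M + M" by linarith+
    qed
    have eM: "e < (t + 2) * M" using st' s by (simp add: algebra_simps)
    then have "(t0 + 3) * M < (t + 2) * M" using e by linarith
    then have "t0 + 3 < t + 2" by (simp only: mult_less_cancel2)
    then have t: "t \<ge> t0" "t \<ge> 1" by linarith+
    have "real e \<le> real ((t + 2) * M)" using eM by linarith
    also have "\<dots> \<le> 3 * real M * real t"
    proof -
      have "(t + 2) * M \<le> (3 * t) * M" using t(2) by (intro mult_le_mono1) auto
      then have "real ((t + 2) * M) \<le> real ((3 * t) * M)" by (simp only: of_nat_le_iff)
      then show ?thesis by (simp add: mult_ac)
    qed
    finally have "real e / \<epsilon> \<le> 3 * real M * real t / \<epsilon>" using \<epsilon> by (simp add: divide_right_mono)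
    also have "\<dots> = (3 * real M / \<epsilon>) * real t" by simp
    also have "\<dots> \<le> real K * real t" unfolding K_def by (intro mult_right_mono) linarith+
    finally have "real q \<le> real (K * t)" using lt by simp
    then have qK: "q \<in> {1..K * t}" using q by (simp only: of_nat_le_iff atLeastAtMost_iff)
    have app: "subsequence f 0 s @ subsequence f s (s + t) = subsequence f 0 (s + t)"
      by (simp add: subsequence_def flip: map_append upt_add_eq_append)
    have Gz: "G (subsequence f 0 (s + t)) ! j = z j" if "j < M * (s + t)" for j
      using that unfolding z[symmetric] by (simp add: subsequence_def)
    have "Q (subsequence f 0 s) (subsequence f s (s + t)) q"
      unfolding Q_def app
    proof (intro conjI allI impI)
      show "1 \<le> q" by fact
      show "q \<le> M * length (subsequence f 0 s)"
        using s by (simp add: subsequence_def mult.commute)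
      fix j assume "M * length (subsequence f 0 s) \<le> j \<and> j < M * length (subsequence f 0 (s + t))"
      then have j: "s * M \<le> j" "j < M * (s + t)" by (simp_all add: subsequence_def mult.commute)
      have *: "i + (j - q - i) = j - q" "j - q - i < e" "j - q + q = j"
        using j s st'(1) by (simp_all add: mult.commute) 
      have "z (j - q) = z j" using rep[OF *(2)] unfolding *(1) *(3) .
      then show "G (subsequence f 0 (s + t)) ! j = G (subsequence f 0 (s + t)) ! (j - q)"
        using Gz[of j] Gz[of "j - q"] j by simp
    qed
    then have "subsequence f s (s + t) \<in> F (subsequence f 0 s) t"
      unfolding F_def using qK by (auto simp: subsequence_def)
    then show False using f t(1) by blast
  qed
  then show ?thesis by blast
qed

section \<open>Blocks of a generalized substitution\<close>

lemma allowed_choices_block: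
  assumes gs: "generalized_substitution n L V C" and w: "w \<in> threshold_words n"
    and a: "allowed_choices C w \<Phi>" and j: "enat j < wlen \<Phi>"
  shows "wnth w j < n" "wnth \<Phi> j \<in> V (wnth w j)" "length (wnth \<Phi> j) = L"
proof -
  have len: "length (wtake j \<Phi>) = j" using j by (cases \<Phi>) (auto simp: subsequence_def)
  have jw: "enat j < wlen w" using a j unfolding allowed_choices_def by auto
  then have "wnth w j \<in> letters w" by (cases w) auto
  then show n: "wnth w j < n" using w unfolding threshold_words_def by auto
  show V: "wnth \<Phi> j \<in> V (wnth w j)"
    using gs w a j jw len unfolding generalized_substitution_def allowed_choices_def by force
  show "length (wnth \<Phi> j) = L"
    using gs n V unfolding generalized_substitution_def by blast
qed

lemma complete_choices_Finite:
  assumes "\<Phi> \<in> complete_choices C (Finite u)"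
  obtains us where "\<Phi> = Finite us" "length us = length u" "allowed_choices C (Finite u) (Finite us)"
  using assms unfolding complete_choices_def by (cases \<Phi>) auto

lemma strict_exponential_growth_doubling:
  assumes "strict_exponential_growth n C"
  obtains p where "\<exists>w\<in>threshold_words n. enat p \<le> wlen w"
    and "\<forall>w\<in>threshold_words n. \<forall>us. enat (length us + p) \<le> wlen w \<longrightarrow>
      allowed_choices C w (Finite us) \<longrightarrow> (\<exists>vs vs'. length vs = p \<and> length vs' = p \<and>
        allowed_choices C w (Finite (us @ vs)) \<and> allowed_choices C w (Finite (us @ vs')) \<and>
        concat (us @ vs) \<noteq> concat (us @ vs'))"
proof -
  obtain p where p: "(\<exists>w\<in>threshold_words n. enat p \<le> wlen w)
      \<and> (\<forall>w\<in>threshold_words n. \<forall>m. enat (m + p) \<le> wlen w \<longrightarrow>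
          (\<forall>us. length us = m \<and> allowed_choices C w (Finite us) \<longrightarrow>
            (\<exists>vs vs'. length vs = p \<and> length vs' = p \<and>
              allowed_choices C w (Finite (us @ vs)) \<and> allowed_choices C w (Finite (us @ vs')) \<and>
              concat (us @ vs) \<noteq> concat (us @ vs'))))"
    using assms unfolding strict_exponential_growth_def by (elim exE)
  show thesis
    using p by (intro that[of p]) blast+
qed

text \<open>
  Otherwise every letter would have only one image: the empty word if \<open>L = 0\<close>, and by the
  pigeonhole principle if \<open>L = 1\<close>, since choosing an image \<open>r b\<close> of each letter \<open>b\<close> then
  gives an injective map on the alphabet, which is onto. Unique images contradict the growth.
\<close>

lemma block_length_ge_2:
  assumes n: "n \<ge> 2" and gs: "generalized_substitution n L V C" and di: "distinct_images n V"
    and gt: "generates_threshold_words n L C" and sg: "strict_exponential_growth n C"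
  shows "L \<ge> 2"
proof (rule ccontr)
  assume L: "\<not> L \<ge> 2"
  have single: "u = u'" if a: "a < n" and u: "u \<in> V a" "u' \<in> V a" for a u u'
  proof -
    have V: "length v = L \<and> set v \<subseteq> {..<n}" if "b < n" "v \<in> V b" for b v
      using gs that unfolding generalized_substitution_def by blast
    show ?thesis
    proof (cases "L = 0")
      case True then show ?thesis using V[OF a u(1)] V[OF a u(2)] by simp
    next
      case False
      with L have L1: "L = 1" by simp
      have "\<exists>v. v \<in> V b" if b: "b < n" for b
      proof -
        have t: "Finite [b] \<in> threshold_words n" using threshold_words_letter n b by blast
        then obtain \<Phi> where "\<Phi> \<in> complete_choices C (Finite [b])"
          using gt unfolding generates_threshold_words_def images_def by blast
        then obtain us where us: "length us = length [b]"
          "allowed_choices C (Finite [b]) (Finite us)" by (rule complete_choices_Finite)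
        show ?thesis using allowed_choices_block(2)[OF gs t us(2), of 0] us(1) by auto
      qed
      then obtain r where r: "\<And>b. b < n \<Longrightarrow> r b \<in> V b" by metis
      have ra: "r b = [hd (r b)]" "hd (r b) < n" if "b < n" for b
        using V[OF that r[OF that]] L1 by (cases "r b"; simp)+
      have injr: "inj_on (\<lambda>b. hd (r b)) {..<n}"
      proof (rule inj_onI)
        fix b c assume bc: "b \<in> {..<n}" "c \<in> {..<n}" "hd (r b) = hd (r c)"
        then have "r b = r c" using ra by (metis lessThan_iff)
        then have "r b \<in> V b \<inter> V c" using r bc by force
        then show "b = c" using di bc unfolding distinct_images_def by blast
      qed
      have surj: "(\<lambda>b. hd (r b)) ` {..<n} = {..<n}"
        by (rule endo_inj_surj[OF _ _ injr]) (use ra in auto)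
      have "v = r a" if v: "v \<in> V a" for v
      proof -
        have "length v = 1" "set v \<subseteq> {..<n}" using V[OF a v] L1 by auto
        then obtain x where x: "v = [x]" "x < n" by (cases v) auto
        then obtain b where b: "b < n" "x = hd (r b)" using surj by (metis imageE lessThan_iff)
        then have "v = r b" using ra x by metis
        then have "v \<in> V a \<inter> V b" using r b v by auto
        then have "a = b" using di a b unfolding distinct_images_def by blast
        then show ?thesis using \<open>v = r b\<close> by simp
      qed
      then show ?thesis using u by metis
    qed
  qed
  obtain p where ex: "\<exists>w\<in>threshold_words n. enat p \<le> wlen w"
    and grow: "\<forall>w\<in>threshold_words n. \<forall>us. enat (length us + p) \<le> wlen w \<longrightarrow>
      allowed_choices C w (Finite us) \<longrightarrow> (\<exists>vs vs'. length vs = p \<and> length vs' = p \<and>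
        allowed_choices C w (Finite (us @ vs)) \<and> allowed_choices C w (Finite (us @ vs')) \<and>
        concat (us @ vs) \<noteq> concat (us @ vs'))"
    by (rule strict_exponential_growth_doubling[OF sg])
  obtain w where w: "w \<in> threshold_words n" "enat p \<le> wlen w" using ex by blast
  have "allowed_choices C w (Finite [])"
    unfolding allowed_choices_def by (simp add: zero_enat_def[symmetric])
  then obtain vs vs' where vs: "length vs = p" "length vs' = p" "allowed_choices C w (Finite vs)"
      "allowed_choices C w (Finite vs')" "concat vs \<noteq> concat vs'"
    using grow[rule_format, OF w(1), of "[]"] w(2) by auto
  have "vs ! j = vs' ! j" if j: "j < p" for j
  proof (rule single[of "wnth w j"])
    show "wnth w j < n" using allowed_choices_block(1)[OF gs w(1) vs(3), of j] j vs(1) by simp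
    show "vs ! j \<in> V (wnth w j)"
      using allowed_choices_block(2)[OF gs w(1) vs(3), of j] j vs(1) by simp
    show "vs' ! j \<in> V (wnth w j)"
      using allowed_choices_block(2)[OF gs w(1) vs(4), of j] j vs(2) by simp
  qed
  then have "vs = vs'" using vs(1,2) by (simp add: nth_equalityI)
  then show False using vs(5) by simp
qed

lemma length_concat_blocks:
  assumes "\<And>u. u \<in> set us \<Longrightarrow> length u = L"
  shows "length (concat us) = L * length us"
  using assms by (induction us) auto

lemma concat_blocks_nth:
  assumes "\<And>u. u \<in> set us \<Longrightarrow> length u = L" "i < L * length us"
  shows "concat us ! i = us ! (i div L) ! (i mod L)"
  using assms
proof (induction us arbitrary: i)
  case (Cons u us)
  have L: "L > 0" using Cons.prems(2) by (cases L) auto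
  show ?case
  proof (cases "i < L")
    case True then show ?thesis using Cons.prems by (simp add: nth_append)
  next
    case False
    then have "i div L = Suc ((i - L) div L)" "i mod L = (i - L) mod L"
      using L by (simp_all add: le_div_geq le_mod_geq)
    then show ?thesis using False Cons.prems Cons.IH[of "i - L"] by (simp add: nth_append)
  qed
qed simp

text \<open>
  An image of a finite threshold word is a threshold word at least twice as long, and the prefixes
  of threshold words form a tree over a finite alphabet.
\<close>

lemma infinite_threshold_word:
  assumes n: "n \<ge> 2" and L: "L \<ge> 2" and gs: "generalized_substitution n L V C"
    and gt: "generates_threshold_words n L C"
  shows "\<exists>f. Infinite f \<in> threshold_words n"
proof -
  have t: "Finite [0] \<in> threshold_words n" using threshold_words_letter[of n 0] n by simp
  have unbounded: "\<exists>u. Finite u \<in> threshold_words n \<and> length u \<ge> k" for k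
  proof (induction k)
    case 0 show ?case using t by blast
  next
    case (Suc k)
    then obtain u where u: "Finite u \<in> threshold_words n" "length u \<ge> k" by blast
    show ?case
    proof (cases "u = []")
      case True
      with u t show ?thesis by (intro exI[of _ "[0]"]) simp
    next
      case False
      obtain \<Phi> where \<Phi>: "\<Phi> \<in> complete_choices C (Finite u)"
        using gt u(1) unfolding generates_threshold_words_def images_def by blast
      then obtain us where us: "\<Phi> = Finite us" "length us = length u"
        "allowed_choices C (Finite u) (Finite us)" by (rule complete_choices_Finite)
      have "flatten L \<Phi> \<in> threshold_words n"
        using gt u(1) \<Phi> unfolding generates_threshold_words_def images_def by blast
      then have "Finite (concat us) \<in> threshold_words n" using us by simp
      moreover have "length v = L" if "v \<in> set us" for v
        using allowed_choices_block(3)[OF gs u(1) us(3)] that by (auto simp: in_set_conv_nth)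
      then have "length (concat us) = L * length u" using length_concat_blocks us(2) by metis
      moreover have "2 * length u \<le> L * length u" using L by simp
      moreover have "length u > 0" using False by simp
      ultimately have "Finite (concat us) \<in> threshold_words n \<and> length (concat us) \<ge> Suc k"
        using u(2) by linarith
      then show ?thesis by blast
    qed
  qed
  have long: "\<exists>u\<in>{u. Finite u \<in> threshold_words n}. length u = k" for k
  proof -
    obtain u where u: "Finite u \<in> threshold_words n" "length u \<ge> k"
      using unbounded by blast
    have "Finite (take k u) \<in> threshold_words n"
      by (rule threshold_words_prefix[of _ "drop k u"]) (simp add: u)
    then show ?thesis using u(2) by (intro bexI[of _ "take k u"]) auto
  qed
  have "\<exists>f. \<forall>k. subsequence f 0 k \<in> {u. Finite u \<in> threshold_words n}"
    by (rule koenig_lists[of "{..<n}"])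
       (use long threshold_words_prefix in \<open>auto simp: threshold_words_def\<close>)
  then show ?thesis using threshold_words_Infinite by blast
qed

section \<open>The tree of images\<close>

text \<open>
  For an infinite word there is always room for the next doubling, so fixing two different
  extensions of every sequence of blocks lets each bit choose between them.
\<close>

lemma binary_tree_of_choices:
  assumes gs: "generalized_substitution n L V C" and sg: "strict_exponential_growth n C"
    and w: "Infinite w \<in> threshold_words n"
  obtains p S where "p \<ge> 1" "\<And>b. length (S b) = p * length b"
    "\<And>b. allowed_choices C (Infinite w) (Finite (S b))"
    "\<And>b x. \<exists>vs. S (b @ [x]) = S b @ vs"
    "\<And>b. concat (S (b @ [True])) \<noteq> concat (S (b @ [False]))"
proof -
  let ?A = "\<lambda>us. allowed_choices C (Infinite w) (Finite us)"
  obtain p where "\<exists>w\<in>threshold_words n. enat p \<le> wlen w"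
    and p: "\<forall>w\<in>threshold_words n. \<forall>us. enat (length us + p) \<le> wlen w \<longrightarrow>
      allowed_choices C w (Finite us) \<longrightarrow> (\<exists>vs vs'. length vs = p \<and> length vs' = p \<and>
        allowed_choices C w (Finite (us @ vs)) \<and> allowed_choices C w (Finite (us @ vs')) \<and>
        concat (us @ vs) \<noteq> concat (us @ vs'))"
    by (rule strict_exponential_growth_doubling[OF sg])
  have grow: "\<exists>vs vs'. length vs = p \<and> length vs' = p \<and>
      ?A (us @ vs) \<and> ?A (us @ vs') \<and> concat (us @ vs) \<noteq> concat (us @ vs')" if "?A us" for us
    by (rule p[rule_format, OF w]) (simp_all add: that)
  have "\<exists>E. (\<forall>x::bool. length (E x) = p \<and> ?A (us @ E x)) \<and>
      concat (us @ E True) \<noteq> concat (us @ E False)" if us: "?A us" for us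
  proof -
    obtain vs vs' where "length vs = p" "length vs' = p" "?A (us @ vs)" "?A (us @ vs')"
      "concat (us @ vs) \<noteq> concat (us @ vs')" using grow[OF us] by blast
    then show ?thesis by (intro exI[of _ "\<lambda>x. if x then vs else vs'"]) auto
  qed
  then have "\<exists>E. \<forall>us. ?A us \<longrightarrow> (\<forall>x::bool. length (E us x) = p \<and> ?A (us @ E us x)) \<and>
      concat (us @ E us True) \<noteq> concat (us @ E us False)" by (intro choice) blast
  then obtain E where E: "\<And>us x. ?A us \<Longrightarrow> length (E us (x::bool)) = p"
    "\<And>us x. ?A us \<Longrightarrow> ?A (us @ E us x)"
    "\<And>us. ?A us \<Longrightarrow> concat (us @ E us True) \<noteq> concat (us @ E us False)" by blast
  define S where "S = foldl (\<lambda>us x. us @ E us x) []"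
  have S: "S [] = []" "S (b @ [x]) = S b @ E (S b) x" for b x by (simp_all add: S_def)
  have A0: "?A []" unfolding allowed_choices_def by (simp add: zero_enat_def[symmetric])
  have A: "?A (S b)" for b by (induction b rule: rev_induct) (simp_all only: S A0 E(2))
  show ?thesis
  proof (rule that[of p S])
    show "p \<ge> 1" using grow[OF A0] by (cases p) auto
    show "length (S b) = p * length b" for b
      by (induction b rule: rev_induct) (simp_all add: S E(1) A)
  qed (use A E(3) S in auto)
qed

section \<open>Images without long repetitions\<close>

theorem mainTheorem6:
  fixes n :: nat
  assumes "n \<ge> 5"
    and "\<exists>L V C. generalized_substitution n L V C \<and> distinct_images n V \<and>
           generates_threshold_words n L C \<and> strict_exponential_growth n C"
  shows "\<forall>\<epsilon>::real. \<epsilon> > 0 \<longrightarrow>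
           (\<exists>w. Infinite w \<in> threshold_words n \<and>
              (\<exists>N. \<forall>x y. x @ y @ x \<in> factors (Infinite w) \<and> length x \<ge> N \<longrightarrow>
                 expo (x @ y @ x) \<le> 1 + \<epsilon>))"
proof (intro allI impI)
  fix \<epsilon> :: real assume \<epsilon>: "\<epsilon> > 0"
  obtain L V C where gs: "generalized_substitution n L V C" and di: "distinct_images n V"
    and gt: "generates_threshold_words n L C" and sg: "strict_exponential_growth n C"
    using assms(2) by blast
  have n: "n \<ge> 2" using assms(1) by simp
  have L: "L \<ge> 2" by (rule block_length_ge_2[OF n gs di gt sg])
  obtain w where w: "Infinite w \<in> threshold_words n"
    using infinite_threshold_word[OF n L gs gt] by blast
  obtain p S where p: "p \<ge> 1" and S: "\<And>b. length (S b) = p * length b"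
    "\<And>b. allowed_choices C (Infinite w) (Finite (S b))"
    "\<And>b x. \<exists>vs. S (b @ [x]) = S b @ vs"
    "\<And>b. concat (S (b @ [True])) \<noteq> concat (S (b @ [False]))"
    using binary_tree_of_choices[OF gs sg w] by metis
  have blocks: "length u = L" if "u \<in> set (S b)" for u b
    using allowed_choices_block(3)[OF gs w S(2)] that by (fastforce simp: in_set_conv_nth)
  have len: "length (concat (S b)) = L * p * length b" for b
    using length_concat_blocks[of "S b" L] blocks S(1) by (simp add: mult.assoc)
  have ext: "\<exists>h. concat (S (b @ [x])) = concat (S b) @ h" for b x
    using S(3)[of b x] by auto
  obtain N f where Nf: "\<And>z i q e. \<lbrakk>\<And>k. subsequence z 0 (L * p * k) = concat (S (subsequence f 0 k));
      e \<ge> N; q \<ge> 1; \<And>j. j < e \<Longrightarrow> z (i + j) = z (i + j + q)\<rbrakk> \<Longrightarrow> real e \<le> \<epsilon> * real q"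
    using avoid_long_repetitions[of "\<lambda>b. concat (S b)" "L * p", OF len ext S(4) \<epsilon>] by blast
  \<comment> \<open>The limit of the sequences of blocks along the branch \<open>f\<close>; the bits up to \<open>j\<close> determine more
    than \<open>j\<close> blocks because \<open>p \<ge> 1\<close>.\<close>
  define \<phi> where "\<phi> j = S (subsequence f 0 (Suc j)) ! j" for j
  have S_nth: "S (subsequence f 0 k) ! j = \<phi> j" if "j < p * k" for j k
  proof -
    have S_add: "take (p * a) (S (subsequence f 0 (a + c))) = S (subsequence f 0 a)" for a c
    proof (induction c)
      case 0 then show ?case by (simp add: S(1) subsequence_def)
    next
      case (Suc c)
      have "subsequence f 0 (a + Suc c) = subsequence f 0 (a + c) @ [f (a + c)]"
        by (simp add: subsequence_def)
      then obtain vs where "S (subsequence f 0 (a + Suc c)) = S (subsequence f 0 (a + c)) @ vs"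
        using S(3) by metis
      then show ?case using Suc by (simp add: S(1) subsequence_def)
    qed
    have S_le: "S (subsequence f 0 b) ! j = S (subsequence f 0 a) ! j"
      if "a \<le> b" "j < p * a" for a b
      using S_add[of a "b - a"] that by (metis le_add_diff_inverse nth_take)
    have "j < Suc j * 1" by simp
    also have "\<dots> \<le> Suc j * p" using p by (intro mult_le_mono2)
    finally have "j < p * Suc j" by (simp only: mult.commute)
    then show ?thesis unfolding \<phi>_def using that S_le[of k "Suc j"] S_le[of "Suc j" k]
      by (cases "k \<le> Suc j") auto
  qed
  have \<phi>_prefix: "subsequence \<phi> 0 (p * k) = S (subsequence f 0 k)" for k
    by (rule nth_equalityI) (simp_all add: S(1) S_nth[unfolded subsequence_def] subsequence_def)
  have allowed: "\<phi> j \<in> C (Infinite w) (subsequence \<phi> 0 j)" for j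
  proof -
    let ?u = "S (subsequence f 0 (Suc j))"
    have "j < Suc j * 1" by simp
    also have "\<dots> \<le> Suc j * p" using p by (intro mult_le_mono2)
    finally have j: "j < p * Suc j" by (simp only: mult.commute)
    have lu: "length ?u = p * Suc j" by (simp only: S(1)) (simp add: subsequence_def)
    have "?u ! j \<in> C (Infinite w) (take j ?u)"
      using S(2)[of "subsequence f 0 (Suc j)"] j lu unfolding allowed_choices_def by simp
    moreover have "take j ?u = subsequence \<phi> 0 j"
      unfolding \<phi>_prefix[symmetric] using j by (simp add: subsequence_def take_map)
    ultimately show ?thesis unfolding \<phi>_def by simp
  qed
  define z where "z k = \<phi> (k div L) ! (k mod L)" for k
  have "Infinite \<phi> \<in> complete_choices C (Infinite w)"
    unfolding complete_choices_def allowed_choices_def using allowed by simp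
  then have "flatten L (Infinite \<phi>) \<in> threshold_words n"
    using gt w unfolding generates_threshold_words_def images_def by blast
  then have z: "Infinite z \<in> threshold_words n" by (simp add: z_def[abs_def])
  have z_prefix: "subsequence z 0 (L * p * k) = concat (S (subsequence f 0 k))" for k
  proof (rule nth_equalityI)
    show "length (subsequence z 0 (L * p * k)) = length (concat (S (subsequence f 0 k)))"
      by (simp add: len subsequence_def)
    fix i assume "i < length (subsequence z 0 (L * p * k))"
    then have i: "i < L * (p * k)" by (simp add: subsequence_def mult.assoc)
    then have "i div L < p * k" by (simp add: less_mult_imp_div_less mult.commute)
    then have "concat (S (subsequence f 0 k)) ! i = z i"
      using concat_blocks_nth[of "S (subsequence f 0 k)" L i] blocks i S_nth[of "i div L" k]
      by (simp add: S(1) z_def subsequence_def)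
    then show "subsequence z 0 (L * p * k) ! i = concat (S (subsequence f 0 k)) ! i"
      using i by (simp add: subsequence_def mult.assoc)
  qed
  have "expo (x @ y @ x) \<le> 1 + \<epsilon>"
    if xyx: "x @ y @ x \<in> factors (Infinite z)" and x: "length x \<ge> Suc N" for x y
  proof -
    \<comment> \<open>The period of \<open>x @ y @ x\<close> may be smaller than the length of \<open>x @ y\<close>, so the excess \<open>e\<close>
      may be larger than the length of \<open>x\<close>.\<close>
    define v where "v = x @ y @ x"
    define q where "q = per v"
    define e where "e = length v - q"
    obtain a b where v: "v = subsequence z a b" using xyx unfolding v_def by auto
    have v_nth: "v ! j = z (a + j)" if "j < length v" for j
      using that unfolding v by (simp add: subsequence_def)
    have "x \<noteq> []" using x by auto
    then have q: "q \<le> length (x @ y)" unfolding q_def v_def by (intro per_le_border) simp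
    have q1: "q \<ge> 1" unfolding q_def by (rule per_pos)
    have e: "e \<ge> N" "length v = q + e" using q x unfolding e_def v_def by simp_all
    have "z (a + j) = z (a + j + q)" if "j < e" for j
      using per_nth[of j v] v_nth[of j] v_nth[of "j + q"] that e(2)
      by (simp add: q_def add.assoc)
    then have "real e \<le> \<epsilon> * real q" using Nf[OF z_prefix e(1) q1] by blast
    then have "real (length v) \<le> (1 + \<epsilon>) * real q" by (simp add: e(2) distrib_right)
    then show ?thesis using q1
      unfolding expo_def v_def[symmetric] q_def[symmetric] by (simp add: pos_divide_le_eq)
  qed
  with z show "\<exists>w. Infinite w \<in> threshold_words n \<and>
      (\<exists>N. \<forall>x y. x @ y @ x \<in> factors (Infinite w) \<and> length x \<ge> N \<longrightarrow>
         expo (x @ y @ x) \<le> 1 + \<epsilon>)" by blast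
qed

end
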